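(* Let $d\ge 1$ and $n\ge 3$ be integers, and let $\mathrm{CTP}(d,n)$ be the full cyclic transversal polytope of length $n$ and rank $d$. Then the following statements hold. 1. The affine hull of $\mathrm{CTP}(d,n)$ is described by the transversal equations $\sum_{\omega\in\mathbb{F}_2^d}x^i_\omega=1$ for $i\in[n]$. 2. $\dim(\mathrm{CTP}(d,n))=n(2^d-1)$. 3. The nonnegativity inequalities $x^i_\omega\ge 0$ ($i\in[n]$, $\omega\in\mathbb{F}_2^d$) define facets of $\mathrm{CTP}(d,n)$, except for the case $(d,n)=(1,3)$. 4. For every $\eta\in\mathbb{F}_2^d\setminus\{0\}$ and every $I\subseteq[n]$ of odd cardinality, the lifted odd-set inequality $$\sum_{i\in I}\ \sum_{\omega\in\mathbb{F}_2^d:\,\eta^T\omega=0}x^i_\omega+\sum_{i\in[n]\setminus I}\ \sum_{\omega\in\mathbb{F}_2^d:\,\eta^T\omega=1}x^i_\omega\ \ge\ 1$$ defines a facet of $\mathrm{CTP}(d,n)$.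
   Context: $\mathbb{F}_2$ is the field with two elements and $[n]=\{1,\dots,n\}$. A cyclic transversal (of the full block configuration all of whose $n$ blocks equal $\mathbb{F}_2^d$) is a sequence $\xi=(\xi(1),\dots,\xi(n))$ with $\xi(i)\in\mathbb{F}_2^d$ and $\sum_{i=1}^n\xi(i)=0$ in $\mathbb{F}_2^d$. Its incidence vector is the vector $x=(x^1,\dots,x^n)$, $x^i\in\{0,1\}^{\mathbb{F}_2^d}$, with $x^i_\omega=1$ if and only if $\xi(i)=\omega$. The full cyclic transversal polytope $\mathrm{CTP}(d,n)\subseteq(\mathbb{R}^{\mathbb{F}_2^d})^n$ is the convex hull of the incidence vectors of all these cyclic transversals. A valid inequality defines a facet of a polytope $P$ if the face of $P$ consisting of the points satisfying it with equality has dimension $\dim(P)-1$. The scalar product $\eta^T\omega$ is computed in $\mathbb{F}_2$. *)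

theory Defs
  imports "HOL-Analysis.Analysis" "HOL-Library.Z2"
begin

text \<open>
  The field with two elements is the type \<^typ>\<open>bit\<close>, so \<open>bit ^ 'd\<close> is the space of column
  vectors of length \<open>d = CARD('d)\<close> over it. The blocks are indexed by a finite type
  \<open>'n\<close> with \<open>n = CARD('n)\<close> elements; nothing below depends on an ordering of the blocks.
  Points of the ambient space are \<open>x :: real ^ (bit ^ 'd) ^ 'n\<close>, and \<open>x $ i $ \<omega>\<close> is the
  coordinate of block \<open>i\<close> at \<open>\<omega>\<close>.
\<close>

instance bit :: finite
proof
  have "(UNIV :: bit set) = {0, 1}"
    by auto
  then show "finite (UNIV :: bit set)"
    by (metis finite.emptyI finite.insertI)
qed

definition cyclic_transversal :: "('n::finite \<Rightarrow> bit ^ 'd) \<Rightarrow> bool" where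
  "cyclic_transversal \<xi> \<longleftrightarrow> (\<Sum>i\<in>UNIV. \<xi> i) = 0"

definition incidence_vector :: "('n::finite \<Rightarrow> bit ^ 'd::finite) \<Rightarrow> real ^ (bit ^ 'd) ^ 'n" where
  "incidence_vector \<xi> = (\<chi> i \<omega>. if \<xi> i = \<omega> then 1 else 0)"

text \<open>The rank \<open>d\<close> and the length \<open>n\<close> are determined by the type at which \<open>CTP\<close> is used.\<close>

definition CTP :: "(real ^ (bit ^ 'd::finite) ^ 'n::finite) set" where
  "CTP = convex hull (incidence_vector ` {\<xi>. cyclic_transversal \<xi>})"

text \<open>The linear inequality \<open>f x \<ge> b\<close> is valid for \<open>P\<close>, and the face it induces is a facet.\<close>

definition defines_facet :: "('a::euclidean_space \<Rightarrow> real) \<Rightarrow> real \<Rightarrow> 'a set \<Rightarrow> bool" where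
  "defines_facet f b P \<longleftrightarrow>
     linear f \<and> (\<forall>x\<in>P. f x \<ge> b) \<and> {x \<in> P. f x = b} facet_of P"

end

theory Submission
  imports Defs
begin

text \<open>
  All four statements are read off from one question: given coefficients \<open>a\<^sub>i(\<omega>)\<close>, what does it mean
  that \<open>\<Sum>\<^sub>i a\<^sub>i(\<xi>(i))\<close> takes the same value for all cyclic transversals \<open>\<xi>\<close> from some family \<open>X\<close>?
  By duality (\<open>in_affine_hull_if_functionals_agree\<close>, \<open>defines_facet_if_functionals_extend\<close>) the affine hull of \<open>X\<close> is determined by the answer, and a
  face is a facet as soon as every functional that is constant on its vertices and on one single further
  vertex is constant on all vertices.

  The answer comes from characteristic 2. Adding \<open>h\<close> in two different blocks keeps the sum of a sequence.
  If \<open>X\<close> contains \<open>\<xi>\<close> and its translates by \<open>h\<close> in the block pairs \<open>{i, j}\<close>, \<open>{i, k}\<close> and \<open>{j, k}\<close>, then in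
  the combination \<open>ij + ik - jk - \<xi>\<close> of their values the blocks \<open>j\<close> and \<open>k\<close> cancel, and
  \<open>2 (a\<^sub>i(\<xi>(i) + h) - a\<^sub>i(\<xi>(i))) = 0\<close> remains (\<open>block_value_translation_invariant\<close>). Three blocks are needed,
  which is the hypothesis \<open>n \<ge> 3\<close>.

  For the family of all cyclic transversals this makes every \<open>a\<^sub>i\<close> constant, so only the \<open>n\<close> orthogonal
  transversal equations hold on the polytope; this gives the affine hull and the dimension.

  For the face \<open>x\<^sup>i\<^sub>\<omega> = 0\<close> the translations must avoid the value \<open>\<omega>\<close> in block \<open>i\<close>. There is room for that
  if another value is free in block \<open>i\<close> (\<open>d \<ge> 2\<close>) or if three blocks other than \<open>i\<close> exist (\<open>n \<ge> 4\<close>), and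
  then the coefficients of every other block are constant. If \<open>d = 1\<close> and \<open>n = 3\<close>, the face is
  spanned by two vertices of a three-dimensional polytope.

  The left-hand side of a lifted odd-set inequality counts the blocks that hit a prescribed residue of
  \<open>\<eta>\<^sup>T\<xi>(i)\<close>. Summing \<open>\<eta>\<^sup>T\<xi>(i)\<close> over all blocks shows that this number is odd, whence validity. On the
  vertices with exactly one hit, translations by the kernel of \<open>\<eta>\<close> show that \<open>a\<^sub>i\<close> takes one value on
  hits and one on non-hits; the difference of the two is the same for all blocks, so the
  functional is an affine function of the number of hits. A vertex with several hits
  forces that function to be constant.
\<close>

section \<open>Affine hulls and facets in terms of linear functionals\<close>

text \<open>
  Decompose \<open>x - t\<close> orthogonally along the direction space of the affine hull. The component \<open>z\<close>
  orthogonal to that space is itself a functional constant on \<open>T\<close>, so it takes the same value at \<open>x\<close> and \<open>t\<close>,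
  which means \<open>z \<bullet> z = 0\<close>.
\<close>

lemma in_affine_hull_if_functionals_agree:
  fixes T :: "'a::euclidean_space set"
  assumes t: "t \<in> T"
    and agree: "\<And>a. (\<And>s. s \<in> T \<Longrightarrow> a \<bullet> s = a \<bullet> t) \<Longrightarrow> a \<bullet> x = a \<bullet> t"
  shows "x \<in> affine hull T"
proof -
  define S where "S = (\<lambda>s. - t + s) ` T"
  obtain y z where y: "y \<in> span S" and z: "\<And>w. w \<in> span S \<Longrightarrow> orthogonal z w"
    and yz: "x - t = y + z"
    using orthogonal_subspace_decomp_exists[of S "x - t"] by blast
  have "z \<bullet> s = z \<bullet> t" if "s \<in> T" for s
    using z[OF span_base, of "- t + s"] that
    by (simp add: S_def orthogonal_def inner_diff_right)
  then have "z \<bullet> (x - t) = 0"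
    using agree by (simp add: inner_diff_right)
  moreover have "z \<bullet> y = 0"
    using z y by (simp add: orthogonal_def)
  ultimately have "z = 0"
    by (simp add: yz inner_add_right)
  then have "x = t + y"
    using yz by (simp add: algebra_simps)
  then show ?thesis
    using y affine_hull_span_gen[OF hull_inc[OF t]] by (auto simp: S_def)
qed

text \<open>
  The point \<open>w\<close> lies outside the face. The extension property says that the face together with \<open>w\<close>
  affinely spans the polytope; one point raises the dimension by at most one, and a proper face has
  smaller dimension, so the face has codimension exactly one.
\<close>

lemma defines_facet_if_functionals_extend:
  fixes V :: "'a::euclidean_space set"
  assumes lin: "linear f"
    and valid: "\<And>v. v \<in> V \<Longrightarrow> f v \<ge> b"
    and tight: "v\<^sub>0 \<in> V" "f v\<^sub>0 = b"
    and slack: "w \<in> V" "f w \<noteq> b"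
    and ext: "\<And>a v. \<lbrakk>\<And>u. u \<in> V \<Longrightarrow> f u = b \<Longrightarrow> a \<bullet> u = a \<bullet> w; v \<in> V\<rbrakk> \<Longrightarrow> a \<bullet> v = a \<bullet> w"
  shows "defines_facet f b (convex hull V)"
proof -
  define F where "F = {x \<in> convex hull V. f x = b}"
  obtain p where p: "\<And>x. f x = p \<bullet> x"
    using adjoint_works[OF lin] by (metis inner_commute inner_real_def mult.right_neutral)
  have valid_hull: "f x \<ge> b" if "x \<in> convex hull V" for x
  proof -
    have "convex hull V \<subseteq> {x. p \<bullet> x \<ge> b}"
      using valid by (intro hull_minimal) (auto simp: p convex_halfspace_ge)
    then show ?thesis
      using that by (auto simp: p)
  qed
  have face: "F face_of convex hull V"
  proof -
    have "F = convex hull V \<inter> {x. p \<bullet> x = b}"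
      by (auto simp: F_def p)
    then show ?thesis
      using face_of_Int_supporting_hyperplane_ge[OF convex_convex_hull, of V b p] valid_hull
      by (simp add: p)
  qed
  have "F \<noteq> convex hull V"
    using slack hull_inc[of w V] by (auto simp: F_def)
  then have upper: "aff_dim F < aff_dim (convex hull V)"
    using face by (simp add: face_of_aff_dim_lt convex_convex_hull)
  have "v \<in> affine hull (insert w F)" if "v \<in> V" for v
  proof (rule in_affine_hull_if_functionals_agree)
    show "w \<in> insert w F"
      by simp
    fix a
    assume agree: "\<And>s. s \<in> insert w F \<Longrightarrow> a \<bullet> s = a \<bullet> w"
    have "a \<bullet> u = a \<bullet> w" if "u \<in> V" "f u = b" for u
      using that by (intro agree) (simp add: F_def hull_inc)
    then show "a \<bullet> v = a \<bullet> w"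
      using \<open>v \<in> V\<close> by (rule ext)
  qed
  then have "aff_dim V \<le> aff_dim (insert w F)"
    by (metis aff_dim_affine_hull aff_dim_subset subsetI)
  then have "aff_dim (convex hull V) \<le> aff_dim F + 1"
    by (auto simp: aff_dim_insert aff_dim_convex_hull split: if_splits)
  then have "F facet_of convex hull V"
    using face upper tight hull_inc[of v\<^sub>0 V] by (auto simp: facet_of_def F_def)
  then show ?thesis
    using lin valid_hull by (simp add: defines_facet_def F_def)
qed

text \<open>
  Block sums are inner products with the vectors \<open>axis i 1\<close>. These are nonzero and pairwise orthogonal, so
  each of the equations lowers the dimension by one.
\<close>

lemma aff_dim_unit_block_sums:
  "aff_dim {x :: real ^ 'b::finite ^ 'n::finite. \<forall>i. (\<Sum>\<omega>\<in>UNIV. x $ i $ \<omega>) = 1}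
     = int CARD('n) * (int CARD('b) - 1)"
proof -
  define W :: "(real ^ 'b ^ 'n) set" where "W = range (\<lambda>i. axis i 1)"
  define L :: "(real ^ 'b ^ 'n) set" where "L = {x. \<forall>i. (\<Sum>\<omega>\<in>UNIV. x $ i $ \<omega>) = 0}"
  define A :: "(real ^ 'b ^ 'n) set" where "A = {x. \<forall>i. (\<Sum>\<omega>\<in>UNIV. x $ i $ \<omega>) = 1}"
  define c :: "real ^ 'b ^ 'n" where "c = (\<chi> i \<omega>. 1 / real CARD('b))"
  have block: "axis i 1 \<bullet> x = (\<Sum>\<omega>\<in>UNIV. x $ i $ \<omega>)" for i and x :: "real ^ 'b ^ 'n"
    by (simp add: inner_axis') (simp add: inner_vec_def)
  have inj: "inj (\<lambda>i. axis i 1 :: real ^ 'b ^ 'n)"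
    by (auto simp: inj_on_def axis_eq_axis)
  have "pairwise orthogonal W"
    by (auto simp: W_def pairwise_def orthogonal_def block) (auto simp: axis_def)
  moreover have "0 \<notin> W"
    by (auto simp: W_def axis_eq_0_iff dest!: sym[of 0])
  ultimately have "dim W = card W"
    using pairwise_orthogonal_independent dim_eq_card_independent by blast
  also have "card W = CARD('n)"
    using inj by (simp add: W_def card_image)
  finally have dimW: "dim (span W) = CARD('n)"
    by simp
  \<comment> \<open>\<open>A\<close> is the translate by \<open>c\<close> of the linear space \<open>L\<close>, the orthogonal complement of \<open>W\<close>.\<close>
  have "L = {y \<in> UNIV. \<forall>x \<in> span W. orthogonal x y}"
  proof -
    have "(\<forall>x \<in> span W. orthogonal x y) \<longleftrightarrow> (\<forall>x \<in> W. orthogonal x y)" for y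
    proof
      assume "\<forall>x \<in> W. orthogonal x y"
      then show "\<forall>x \<in> span W. orthogonal x y"
        using orthogonal_to_span[of _ W y] by (simp add: orthogonal_commute[of y])
    qed (simp add: span_base)
    then show ?thesis
      by (auto simp: L_def W_def orthogonal_def block)
  qed
  then have "dim L + CARD('n) = CARD('n) * CARD('b)"
    using dim_subspace_orthogonal_to_vectors[of "span W" UNIV] dimW by simp
  then have "int (dim L) = int CARD('n) * int CARD('b) - int CARD('n)"
    by (metis add_diff_cancel_right' of_nat_add of_nat_mult)
  moreover have "aff_dim A = int (dim L)"
  proof -
    have "c \<in> A"
      by (simp add: A_def c_def)
    moreover have "(\<lambda>x. x - c) ` A = L"
    proof (intro set_eqI iffI)
      fix y
      assume "y \<in> L"
      then have "y + c \<in> A"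
        by (simp add: L_def A_def c_def sum.distrib)
      then show "y \<in> (\<lambda>x. x - c) ` A"
        by (intro image_eqI[of _ _ "y + c"]) auto
    qed (auto simp: L_def A_def c_def sum_subtractf)
    ultimately show ?thesis
      using aff_dim_eq_dim_subtract[of c A] by (simp add: hull_inc)
  qed
  ultimately show ?thesis
    by (simp add: A_def algebra_simps)
qed

section \<open>Cyclic transversals\<close>

lemma add_self_bit_vec [simp]: "x + x = (0 :: bit ^ 'd)"
proof -
  have "a + a = 0" for a :: bit
    by (cases a) auto
  then show ?thesis
    by (simp only: vec_eq_iff vector_add_component zero_index) simp
qed

lemma add_self_left_bit_vec [simp]: "x + (x + y) = (y :: bit ^ 'd)"
  by (simp flip: add.assoc)

lemma card_bit_vec: "CARD(bit ^ 'd::finite) = 2 ^ CARD('d)"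
proof -
  have "(UNIV :: bit set) = {0, 1}"
    by auto
  then have "CARD(bit) = 2"
    by (metis card_2_iff zero_neq_one)
  then show ?thesis
    by simp
qed

lemma sum_fun_upd:
  fixes g :: "'n::finite \<Rightarrow> 'a \<Rightarrow> 'b::ab_group_add"
  shows "(\<Sum>m\<in>UNIV. g m ((\<xi>(i := x)) m)) = (\<Sum>m\<in>UNIV. g m (\<xi> m)) - g i (\<xi> i) + g i x"
proof -
  have "(\<Sum>m\<in>UNIV - {i}. g m ((\<xi>(i := x)) m)) = (\<Sum>m\<in>UNIV - {i}. g m (\<xi> m))"
    by (intro sum.cong) auto
  then show ?thesis
    by (simp add: sum.remove[of UNIV i])
qed

lemma ex_not_in_if_card_less:
  assumes "card (A :: 'a::finite set) < CARD('a)"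
  obtains x where "x \<notin> A"
proof -
  have "A \<noteq> UNIV"
    using assms by auto
  then show ?thesis
    using that by blast
qed

lemma ex_other_index:
  assumes "CARD('n::finite) \<ge> 3"
  obtains k where "k \<noteq> i" "k \<noteq> (j :: 'n)"
proof -
  have "card {i, j} < CARD('n)"
    using assms card_insert_le_m1[of 2 "{j}" i] by auto
  then obtain k where "k \<notin> {i, j}"
    by (rule ex_not_in_if_card_less)
  then show ?thesis
    by (intro that) auto
qed

text \<open>
  In characteristic 2 adding the total sum to one entry makes the total sum zero; so a cyclic
  transversal may be prescribed arbitrarily outside of one block \<open>k\<close>.
\<close>

definition complete_at :: "'n \<Rightarrow> ('n::finite \<Rightarrow> bit ^ 'd) \<Rightarrow> 'n \<Rightarrow> bit ^ 'd" where
  "complete_at k \<zeta> = \<zeta>(k := \<zeta> k + (\<Sum>m\<in>UNIV. \<zeta> m))"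

lemma cyclic_complete_at: "cyclic_transversal (complete_at k \<zeta>)"
  unfolding cyclic_transversal_def complete_at_def
  using sum_fun_upd[of "\<lambda>_ x. x" \<zeta> k "\<zeta> k + (\<Sum>m\<in>UNIV. \<zeta> m)"]
  by (simp del: fun_upd_apply)

lemma complete_at_other: "m \<noteq> k \<Longrightarrow> complete_at k \<zeta> m = \<zeta> m"
  by (simp add: complete_at_def)

definition translate_pair :: "'n \<Rightarrow> 'n \<Rightarrow> bit ^ 'd \<Rightarrow> ('n::finite \<Rightarrow> bit ^ 'd) \<Rightarrow> 'n \<Rightarrow> bit ^ 'd" where
  "translate_pair i j h \<xi> = \<xi>(i := \<xi> i + h, j := \<xi> j + h)"

lemma sum_translate_pair:
  fixes g :: "'n::finite \<Rightarrow> bit ^ 'd \<Rightarrow> 'b::ab_group_add"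
  assumes "i \<noteq> j"
  shows "(\<Sum>m\<in>UNIV. g m (translate_pair i j h \<xi> m)) =
    (\<Sum>m\<in>UNIV. g m (\<xi> m)) + (g i (\<xi> i + h) - g i (\<xi> i)) + (g j (\<xi> j + h) - g j (\<xi> j))"
  using assms by (simp add: translate_pair_def sum_fun_upd del: fun_upd_apply) (simp add: algebra_simps)

lemma cyclic_translate_pair:
  assumes "i \<noteq> j" "cyclic_transversal \<xi>"
  shows "cyclic_transversal (translate_pair i j h \<xi>)"
  using sum_translate_pair[OF assms(1), of "\<lambda>_ x. x" h \<xi>] assms(2)
  by (simp add: cyclic_transversal_def algebra_simps)

lemma translate_pair_apply:
  "translate_pair i j h \<xi> m = (if m = i \<or> m = j then \<xi> m + h else \<xi> m)"
  by (auto simp: translate_pair_def)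

text \<open>
  Adding the equations for the translates along \<open>{i, j}\<close> and \<open>{i, k}\<close> and subtracting those for \<open>{j, k}\<close> and
  for \<open>\<xi>\<close> cancels the contributions of \<open>j\<close> and \<open>k\<close> and counts the change in block \<open>i\<close> twice. The
  family \<open>X\<close> is a parameter because each face has its own set of vertices.
\<close>

lemma block_value_translation_invariant:
  fixes g :: "'n::finite \<Rightarrow> bit ^ 'd \<Rightarrow> real"
  assumes distinct: "i \<noteq> j" "i \<noteq> k" "j \<noteq> k"
    and const: "\<And>\<xi>. \<xi> \<in> X \<Longrightarrow> (\<Sum>m\<in>UNIV. g m (\<xi> m)) = c"
    and X: "\<xi> \<in> X" "translate_pair i j h \<xi> \<in> X" "translate_pair i k h \<xi> \<in> X"
      "translate_pair j k h \<xi> \<in> X"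
  shows "g i (\<xi> i + h) = g i (\<xi> i)"
  using const[OF X(1)] const[OF X(2)] const[OF X(3)] const[OF X(4)]
  unfolding sum_translate_pair[OF distinct(1)] sum_translate_pair[OF distinct(2)]
    sum_translate_pair[OF distinct(3)]
  by linarith

lemma inner_incidence_vector:
  "a \<bullet> incidence_vector \<xi> = (\<Sum>m\<in>UNIV. a $ m $ \<xi> m)"
  by (simp add: inner_vec_def incidence_vector_def if_distrib cong: if_cong)

lemma block_sum_incidence_vector: "(\<Sum>\<omega>\<in>UNIV. incidence_vector \<xi> $ i $ \<omega>) = 1"
  by (simp add: incidence_vector_def)

section \<open>The affine hull\<close>

text \<open>
  A functional that is constant on all cyclic transversals has constant coefficients in each block: start
  from the zero sequence and translate by \<open>\<omega>\<close>. Its value is then determined by the block sums.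
\<close>

lemma affine_hull_CTP:
  assumes n: "CARD('n::finite) \<ge> 3"
  shows "affine hull CTP
    = {x :: real ^ (bit ^ 'd::finite) ^ 'n. \<forall>i. (\<Sum>\<omega>\<in>UNIV. x $ i $ \<omega>) = 1}" (is "_ = ?A")
proof -
  define V :: "(real ^ (bit ^ 'd) ^ 'n) set" where
    "V = incidence_vector ` {\<xi>. cyclic_transversal \<xi>}"
  have "affine ?A"
    by (auto simp: affine_def sum.distrib simp flip: sum_distrib_left)
  then have "affine hull V \<subseteq> ?A"
    by (intro hull_minimal) (auto simp: V_def block_sum_incidence_vector)
  moreover have "x \<in> affine hull V" if "x \<in> ?A" for x
  proof (rule in_affine_hull_if_functionals_agree)
    show zero: "incidence_vector (\<lambda>_. 0) \<in> V"
      by (auto simp: V_def cyclic_transversal_def)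
    fix a
    assume agree: "\<And>s. s \<in> V \<Longrightarrow> a \<bullet> s = a \<bullet> incidence_vector (\<lambda>_. 0)"
    have const: "a $ i $ \<omega> = a $ i $ 0" for i \<omega>
    proof -
      obtain j where j: "j \<noteq> i"
        using ex_other_index[OF n] by metis
      obtain k where k: "k \<noteq> i" "k \<noteq> j"
        using ex_other_index[OF n] by metis
      have "(\<lambda>_. 0) \<in> {\<xi> :: 'n \<Rightarrow> bit ^ 'd. cyclic_transversal \<xi>}"
        by (simp add: cyclic_transversal_def)
      moreover have "(\<Sum>m\<in>UNIV. a $ m $ \<xi> m) = a \<bullet> incidence_vector (\<lambda>_. 0)"
        if "\<xi> \<in> {\<xi>. cyclic_transversal \<xi>}" for \<xi>
        using agree[of "incidence_vector \<xi>"] that unfolding V_def inner_incidence_vector by blast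
      ultimately show ?thesis
        using block_value_translation_invariant[of i j k "{\<xi>. cyclic_transversal \<xi>}"
            "\<lambda>m \<omega>. a $ m $ \<omega>" "a \<bullet> incidence_vector (\<lambda>_. 0)" "\<lambda>_. 0" \<omega>] j k
        by (simp add: cyclic_translate_pair)
    qed
    have "a \<bullet> x = (\<Sum>i\<in>UNIV. a $ i $ 0 * (\<Sum>\<omega>\<in>UNIV. x $ i $ \<omega>))"
      unfolding inner_vec_def inner_real_def sum_distrib_left
      by (intro sum.cong refl) (metis const)
    also have "\<dots> = a \<bullet> incidence_vector (\<lambda>_. 0)"
      using that by (simp add: inner_incidence_vector)
    finally show "a \<bullet> x = a \<bullet> incidence_vector (\<lambda>_. 0)" .
  qed
  ultimately show ?thesis
    by (auto simp: CTP_def V_def)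
qed

lemma aff_dim_CTP:
  assumes n: "CARD('n::finite) \<ge> 3"
  shows "aff_dim (CTP :: (real ^ (bit ^ 'd::finite) ^ 'n) set) = int CARD('n) * (2 ^ CARD('d) - 1)"
proof -
  have "aff_dim (CTP :: (real ^ (bit ^ 'd) ^ 'n) set) = int CARD('n) * (int CARD(bit ^ 'd) - 1)"
    using aff_dim_affine_hull[of "CTP :: (real ^ (bit ^ 'd) ^ 'n) set"]
    unfolding affine_hull_CTP[OF n] aff_dim_unit_block_sums by (rule sym)
  then show ?thesis
    unfolding card_bit_vec by simp
qed

section \<open>Nonnegativity inequalities\<close>

lemma linear_coordinate: "linear (\<lambda>x :: real ^ 'b::finite ^ 'n::finite. x $ i $ \<omega>)"
  by (rule linearI) auto

text \<open>
  It suffices to make the coefficients of every block \<open>j \<noteq> i\<^sub>0\<close> constant: a vertex with \<open>\<xi> i\<^sub>0 \<noteq> \<omega>\<^sub>0\<close>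
  lies on the face, and any other vertex agrees with the additional vertex \<open>w\<close> in block \<open>i\<^sub>0\<close>.
\<close>

lemma nonnegativity_defines_facet:
  fixes i\<^sub>0 :: "'n::finite" and \<omega>\<^sub>0 :: "bit ^ 'd::finite"
  assumes n: "CARD('n) \<ge> 3" and not13: "CARD('d) \<ge> 2 \<or> CARD('n) \<ge> 4"
  shows "defines_facet (\<lambda>x. x $ i\<^sub>0 $ \<omega>\<^sub>0) 0 (CTP :: (real ^ (bit ^ 'd) ^ 'n) set)"
proof -
  define V :: "(real ^ (bit ^ 'd) ^ 'n) set" where
    "V = incidence_vector ` {\<xi>. cyclic_transversal \<xi>}"
  define X :: "('n \<Rightarrow> bit ^ 'd) set" where "X = {\<xi>. cyclic_transversal \<xi> \<and> \<xi> i\<^sub>0 \<noteq> \<omega>\<^sub>0}"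
  obtain j\<^sub>0 where j0: "j\<^sub>0 \<noteq> i\<^sub>0"
    using ex_other_index[OF n] by metis
  define w :: "'n \<Rightarrow> bit ^ 'd" where "w = complete_at j\<^sub>0 (\<lambda>_. \<omega>\<^sub>0)"
  define v :: "'n \<Rightarrow> bit ^ 'd" where "v = complete_at j\<^sub>0 (\<lambda>_. \<omega>\<^sub>0 + 1)"
  have one: "(1 :: bit ^ 'd) \<noteq> 0"
    by (simp add: vec_eq_iff)
  have "defines_facet (\<lambda>x. x $ i\<^sub>0 $ \<omega>\<^sub>0) 0 (convex hull V)"
  proof (rule defines_facet_if_functionals_extend)
    show "linear (\<lambda>x :: real ^ (bit ^ 'd) ^ 'n. x $ i\<^sub>0 $ \<omega>\<^sub>0)"
      by (rule linear_coordinate)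
    show "0 \<le> u $ i\<^sub>0 $ \<omega>\<^sub>0" if "u \<in> V"
      for u :: "real ^ (bit ^ 'd) ^ 'n"
      using that by (auto simp: V_def incidence_vector_def)
    show "incidence_vector v \<in> V"
      by (simp add: V_def v_def cyclic_complete_at)
    show "incidence_vector v $ i\<^sub>0 $ \<omega>\<^sub>0 = 0"
      using j0 one by (simp add: incidence_vector_def v_def complete_at_other)
    show w: "incidence_vector w \<in> V"
      by (simp add: V_def w_def cyclic_complete_at)
    have w0: "w i\<^sub>0 = \<omega>\<^sub>0"
      using j0 by (simp add: w_def complete_at_other)
    then show "incidence_vector w $ i\<^sub>0 $ \<omega>\<^sub>0 \<noteq> 0"
      by (simp add: incidence_vector_def)
    fix a u :: "real ^ (bit ^ 'd) ^ 'n"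
    assume tight: "\<And>u. u \<in> V \<Longrightarrow> u $ i\<^sub>0 $ \<omega>\<^sub>0 = 0 \<Longrightarrow>
        a \<bullet> u = a \<bullet> incidence_vector w"
    have agree: "(\<Sum>m\<in>UNIV. a $ m $ \<xi> m) = a \<bullet> incidence_vector w" if "\<xi> \<in> X" for \<xi>
      using tight[of "incidence_vector \<xi>"] that
      by (auto simp: V_def X_def inner_incidence_vector) (simp add: incidence_vector_def)
    note transl = block_value_translation_invariant[where X = X and g = "\<lambda>m \<omega>. a $ m $ \<omega>", OF _ _ _ agree]
    have const: "a $ j $ \<beta> = a $ j $ \<beta>'" if j: "j \<noteq> i\<^sub>0" for j \<beta> \<beta>'
    proof -
      define h where "h = \<beta> + \<beta>'"
      obtain k where k: "k \<noteq> j" "k \<noteq> i\<^sub>0"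
        using ex_other_index[OF n] by metis
      have "a $ j $ (\<beta> + h) = a $ j $ \<beta>"
        using not13
      proof
        assume "CARD('d) \<ge> 2"
        then have "(2::nat) ^ 2 \<le> CARD(bit ^ 'd)"
          unfolding card_bit_vec by (intro power_increasing) auto
        then have "card {\<omega>\<^sub>0, \<omega>\<^sub>0 + h} < CARD(bit ^ 'd)"
          using card_insert_le_m1[of 2 "{\<omega>\<^sub>0 + h}" \<omega>\<^sub>0] by simp
        \<comment> \<open>With neither \<open>\<alpha>\<close> nor \<open>\<alpha> + h\<close> equal to \<open>\<omega>\<^sub>0\<close>, block \<open>i\<^sub>0\<close> may be translated by \<open>h\<close>.\<close>
        then obtain \<alpha> where "\<alpha> \<notin> {\<omega>\<^sub>0, \<omega>\<^sub>0 + h}"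
          by (rule ex_not_in_if_card_less)
        then have \<alpha>: "\<alpha> \<noteq> \<omega>\<^sub>0" and \<alpha>h: "\<alpha> + h \<noteq> \<omega>\<^sub>0"
          by (auto simp: add.assoc)
        define \<xi> where "\<xi> = complete_at k (\<lambda>m. if m = i\<^sub>0 then \<alpha> else \<beta>)"
        have "\<xi> i\<^sub>0 = \<alpha>" "\<xi> j = \<beta>" "cyclic_transversal \<xi>"
          using k j by (simp_all add: \<xi>_def complete_at_other cyclic_complete_at)
        then show ?thesis
          using transl[of j i\<^sub>0 k \<xi> h] k j \<alpha> \<alpha>h
          by (simp add: X_def cyclic_translate_pair translate_pair_apply)
      next
        assume "CARD('n) \<ge> 4"
        then have "card {i\<^sub>0, j, k} < CARD('n)"
          using k j by simp
        then obtain l where "l \<notin> {i\<^sub>0, j, k}"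
          by (rule ex_not_in_if_card_less)
        then have l: "l \<noteq> i\<^sub>0" "l \<noteq> j" "l \<noteq> k"
          by auto
        \<comment> \<open>The blocks \<open>j\<close>, \<open>k\<close>, \<open>l\<close> are translated, so block \<open>i\<^sub>0\<close> keeps an admissible value.\<close>
        define \<xi> where "\<xi> = complete_at k (\<lambda>m. if m = i\<^sub>0 then \<omega>\<^sub>0 + 1 else \<beta>)"
        have "\<xi> i\<^sub>0 \<noteq> \<omega>\<^sub>0" "\<xi> j = \<beta>" "cyclic_transversal \<xi>"
          using k j one by (simp_all add: \<xi>_def complete_at_other cyclic_complete_at)
        then show ?thesis
          using transl[of j k l \<xi> h] k j l
          by (auto simp: X_def cyclic_translate_pair translate_pair_apply)
      qed
      then show ?thesis
        by (simp add: h_def)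
    qed
    assume "u \<in> V"
    then obtain \<xi> where \<xi>: "cyclic_transversal \<xi>" "u = incidence_vector \<xi>"
      by (auto simp: V_def)
    show "a \<bullet> u = a \<bullet> incidence_vector w"
    proof (cases "\<xi> i\<^sub>0 = \<omega>\<^sub>0")
      case True
      then show ?thesis
        unfolding \<xi> inner_incidence_vector using w0 const by (intro sum.cong) metis+
    next
      case False
      then show ?thesis
        using agree[of \<xi>] \<xi> by (simp add: X_def inner_incidence_vector)
    qed
  qed
  then show ?thesis
    by (simp add: CTP_def V_def)
qed

text \<open>
  Here a facet would have dimension two, but at most two vertices lie on the face, so it is at most a
  segment.
\<close>

lemma nonnegativity_not_facet_rank_1_length_3:
  fixes i\<^sub>0 :: "'n::finite" and \<omega>\<^sub>0 :: "bit ^ 'd::finite"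
  assumes d: "CARD('d) = 1" and n: "CARD('n) = 3"
  shows "\<not> defines_facet (\<lambda>x. x $ i\<^sub>0 $ \<omega>\<^sub>0) 0 (CTP :: (real ^ (bit ^ 'd) ^ 'n) set)"
proof
  define V :: "(real ^ (bit ^ 'd) ^ 'n) set" where
    "V = incidence_vector ` {\<xi>. cyclic_transversal \<xi>}"
  define X :: "('n \<Rightarrow> bit ^ 'd) set" where "X = {\<xi>. cyclic_transversal \<xi> \<and> \<xi> i\<^sub>0 \<noteq> \<omega>\<^sub>0}"
  define F where "F = {x \<in> convex hull V. x $ i\<^sub>0 $ \<omega>\<^sub>0 = 0}"
  assume "defines_facet (\<lambda>x. x $ i\<^sub>0 $ \<omega>\<^sub>0) 0 (CTP :: (real ^ (bit ^ 'd) ^ 'n) set)"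
  then have face: "F face_of convex hull V" and dimF: "aff_dim F = aff_dim (convex hull V) - 1"
    by (auto simp: defines_facet_def facet_of_def CTP_def V_def F_def)
  have card2: "CARD(bit ^ 'd) = 2"
    using card_bit_vec[where 'd = 'd] d by simp
  have "aff_dim (convex hull V) = 3"
    using aff_dim_CTP[where 'd = 'd and 'n = 'n] d n by (simp add: CTP_def V_def)
  moreover have "aff_dim F \<le> 1"
  proof -
    have "finite V"
      by (simp add: V_def)
    then obtain S where S: "S \<subseteq> V" "F = convex hull S"
      using face_of_convex_hull_subset face finite_imp_compact by metis
    have SX: "S \<subseteq> incidence_vector ` X"
    proof
      fix s
      assume s: "s \<in> S"
      then obtain \<xi> where \<xi>: "s = incidence_vector \<xi>" "cyclic_transversal \<xi>"
        using S by (auto simp: V_def)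
      moreover have "s $ i\<^sub>0 $ \<omega>\<^sub>0 = 0"
        using s S hull_inc[of s S] by (auto simp: F_def)
      ultimately show "s \<in> incidence_vector ` X"
        by (auto simp: X_def incidence_vector_def)
    qed
    obtain j where j: "j \<noteq> i\<^sub>0"
      using ex_other_index[of i\<^sub>0] n by (metis order_refl)
    obtain k where k: "k \<noteq> i\<^sub>0" "k \<noteq> j"
      using ex_other_index[of i\<^sub>0 j] n by (metis order_refl)
    have UNIV_n: "UNIV = {i\<^sub>0, j, k}"
      using n j k by (intro card_subset_eq[symmetric]) auto
    \<comment> \<open>Block \<open>i\<^sub>0\<close> has only one admissible value, and block \<open>k\<close> is determined by the other two.\<close>
    have "inj_on (\<lambda>\<xi>. \<xi> j) X"
    proof (rule inj_onI)
      fix \<xi> \<xi>'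
      assume X: "\<xi> \<in> X" "\<xi>' \<in> X" and eqj: "\<xi> j = \<xi>' j"
      have eqi: "\<xi> i\<^sub>0 = \<xi>' i\<^sub>0"
      proof (rule ccontr)
        assume "\<xi> i\<^sub>0 \<noteq> \<xi>' i\<^sub>0"
        then have "card {\<omega>\<^sub>0, \<xi> i\<^sub>0, \<xi>' i\<^sub>0} = 3"
          using X by (auto simp: X_def)
        then show False
          using card_mono[of UNIV "{\<omega>\<^sub>0, \<xi> i\<^sub>0, \<xi>' i\<^sub>0}"] card2 by simp
      qed
      have "\<xi> i\<^sub>0 + (\<xi> j + \<xi> k) = \<xi>' i\<^sub>0 + (\<xi>' j + \<xi>' k)"
        using X j k by (simp add: X_def cyclic_transversal_def UNIV_n)
      then have "\<xi> k = \<xi>' k"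
        using eqi eqj by simp
      moreover have "m \<in> {i\<^sub>0, j, k}" for m
        unfolding UNIV_n[symmetric] by simp
      ultimately show "\<xi> = \<xi>'"
        using eqi eqj by fastforce
    qed
    then have "card X \<le> 2"
      using card_inj_on_le[of "\<lambda>\<xi>. \<xi> j" X UNIV] card2 by simp
    then have "card (incidence_vector ` X) \<le> 2"
      using card_image_le[of X incidence_vector] by simp
    then have "card S \<le> 2"
      using card_mono[OF _ SX] by simp
    moreover have "finite S"
      using S \<open>finite V\<close> by (blast intro: finite_subset)
    ultimately show ?thesis
      using aff_dim_le_card[of S] S by (simp add: aff_dim_convex_hull)
  qed
  ultimately show False
    using dimF by simp
qed

section \<open>Lifted odd-set inequalities\<close>

lemma scalar_product_add:
  "scalar_product (\<eta> :: bit ^ 'd::finite) (x + y) = scalar_product \<eta> x + scalar_product \<eta> y"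
  by (simp only: scalar_product_def vector_add_component distrib_left sum.distrib)

lemma scalar_product_sum:
  "scalar_product (\<eta> :: bit ^ 'd::finite) (\<Sum>i\<in>A. f i) = (\<Sum>i\<in>A. scalar_product \<eta> (f i))"
proof (induction A rule: infinite_finite_induct)
  case (insert a A)
  then show ?case
    by (simp add: scalar_product_add del: add_bit_eq_xor)
qed (simp_all add: scalar_product_def)

lemma scalar_product_surj:
  assumes "(\<eta> :: bit ^ 'd::finite) \<noteq> 0"
  obtains x where "scalar_product \<eta> x = b"
proof -
  obtain m where m: "\<eta> $ m \<noteq> 0"
    using assms by (auto simp: vec_eq_iff)
  have "scalar_product \<eta> (axis m b) = b"
    using m by (simp add: scalar_product_def axis_def if_distrib cong: if_cong del: mult_bit_eq_and)
  then show ?thesis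
    by (rule that)
qed

lemma sum_bit_eq_1_iff:
  assumes "finite A"
  shows "(\<Sum>i\<in>A. b i) = (1 :: bit) \<longleftrightarrow> odd (card {i \<in> A. b i = 1})"
  using assms
proof (induction A rule: finite_induct)
  case (insert a A)
  have "{i \<in> insert a A. b i = 1} = (if b a = 1 then insert a {i \<in> A. b i = 1} else {i \<in> A. b i = 1})"
    by auto
  then show ?case
    using insert by (cases "b a") auto
qed simp

text \<open>The blocks that contribute 1 to the left-hand side of the lifted odd-set inequality.\<close>

definition hits :: "bit ^ 'd::finite \<Rightarrow> 'n set \<Rightarrow> ('n \<Rightarrow> bit ^ 'd) \<Rightarrow> 'n set" where
  "hits \<eta> I \<xi> = {i. scalar_product \<eta> (\<xi> i) = (if i \<in> I then 0 else 1)}"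

text \<open>
  Over the field with two elements, block \<open>i\<close> is a hit iff \<open>\<eta>\<^sup>T\<xi>(i) + [i \<in> I] = 1\<close>. Summed over all blocks,
  the first term gives 0 by cyclicity and the second gives \<open>|I| = 1\<close>.
\<close>

lemma odd_card_hits:
  fixes I :: "'n::finite set"
  assumes "cyclic_transversal \<xi>" "odd (card I)"
  shows "odd (card (hits \<eta> I \<xi>))"
proof -
  define e :: "'n \<Rightarrow> bit" where "e i = of_bool (i \<in> I)" for i
  have "(\<Sum>i\<in>UNIV. scalar_product \<eta> (\<xi> i)) = 0"
    unfolding scalar_product_sum[symmetric]
    using assms(1) by (simp add: cyclic_transversal_def scalar_product_def)
  moreover have "(\<Sum>i\<in>UNIV. e i) = 1"
    using assms(2) by (subst sum_bit_eq_1_iff) (auto simp: e_def)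
  ultimately have "(\<Sum>i\<in>UNIV. scalar_product \<eta> (\<xi> i) + e i) = 1"
    by (simp only: sum.distrib add_0)
  moreover have "{i \<in> UNIV. scalar_product \<eta> (\<xi> i) + e i = 1} = hits \<eta> I \<xi>"
  proof -
    have "scalar_product \<eta> (\<xi> i) + e i = 1 \<longleftrightarrow> i \<in> hits \<eta> I \<xi>" for i
      by (cases "scalar_product \<eta> (\<xi> i)") (auto simp: e_def hits_def)
    then show ?thesis
      by blast
  qed
  ultimately show ?thesis
    using sum_bit_eq_1_iff[of UNIV "\<lambda>i. scalar_product \<eta> (\<xi> i) + e i"] by simp
qed

definition odd_set_lhs :: "bit ^ 'd::finite \<Rightarrow> 'n set \<Rightarrow> real ^ (bit ^ 'd) ^ 'n::finite \<Rightarrow> real" where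
  "odd_set_lhs \<eta> I x = (\<Sum>i\<in>I. \<Sum>\<omega> | scalar_product \<eta> \<omega> = 0. x $ i $ \<omega>)
               + (\<Sum>i\<in>UNIV - I. \<Sum>\<omega> | scalar_product \<eta> \<omega> = 1. x $ i $ \<omega>)"

lemma linear_odd_set_lhs: "linear (odd_set_lhs \<eta> I)"
  unfolding odd_set_lhs_def
  by (intro linear_compose_add linear_compose_sum ballI linear_coordinate)

lemma odd_set_lhs_incidence_vector:
  "odd_set_lhs \<eta> I (incidence_vector \<xi>) = card (hits \<eta> I \<xi>)"
proof -
  have inner: "(\<Sum>\<omega> | scalar_product \<eta> \<omega> = b. incidence_vector \<xi> $ i $ \<omega>)
      = of_bool (scalar_product \<eta> (\<xi> i) = b)" for b i
    by (simp add: incidence_vector_def)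
  have "odd_set_lhs \<eta> I (incidence_vector \<xi>)
      = (\<Sum>i\<in>I. of_bool (i \<in> hits \<eta> I \<xi>)) + (\<Sum>i\<in>UNIV - I. of_bool (i \<in> hits \<eta> I \<xi>))"
    unfolding odd_set_lhs_def inner by (intro arg_cong2[of _ _ _ _ "(+)"] sum.cong) (auto simp: hits_def)
  also have "\<dots> = (\<Sum>i\<in>UNIV. of_bool (i \<in> hits \<eta> I \<xi>))"
    unfolding add.commute[of "sum _ I"] by (rule sum.subset_diff[symmetric]) auto
  also have "\<dots> = card (hits \<eta> I \<xi>)"
    by simp
  finally show ?thesis .
qed

text \<open>
  Prescribing a single hit outside of block \<open>k\<close> is enough: parity rules out a second hit at \<open>k\<close>, whatever
  value the completion puts there.
\<close>

lemma hits_complete_at: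
  assumes I: "odd (card I)" and "i \<noteq> k" and hit: "hits \<eta> I \<zeta> - {k} = {i}"
  shows "hits \<eta> I (complete_at k \<zeta>) = {i}"
proof -
  let ?H = "hits \<eta> I (complete_at k \<zeta>)"
  have "?H - {k} = hits \<eta> I \<zeta> - {k}"
    by (intro set_eqI) (auto simp: hits_def complete_at_other)
  then have H: "?H - {k} = {i}"
    using hit by (rule trans)
  have "k \<notin> ?H"
  proof
    assume "k \<in> ?H"
    then have "?H = {k, i}"
      using insert_Diff[of k ?H] H by simp
    then have "card ?H = 2"
      using \<open>i \<noteq> k\<close> by simp
    moreover have "odd (card ?H)"
      using I by (intro odd_card_hits cyclic_complete_at)
    ultimately show False
      by simp
  qed
  then show ?thesis
    using H by (metis Diff_empty Diff_insert0)
qed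

text \<open>
  Let a functional be constant on the vertices with exactly one hit. Translations by the kernel of \<open>\<eta>\<close>
  preserve the hits, so its coefficient at \<open>(i, \<omega>)\<close> depends only on \<open>i\<close> and on whether \<open>\<omega>\<close> is a hit there:
  it is that of a fixed hit \<open>\<beta> i\<close> or of a fixed non-hit \<open>\<gamma> i\<close>. Their difference \<open>D i\<close> is
  the same for all blocks, as each block can carry the only hit. The value at \<open>\<xi>\<close> is thus
  \<open>Q + D \<cdot> card (hits \<eta> I \<xi>)\<close>, and the vertex \<open>w\<close>, which has more than one hit, yields \<open>D = 0\<close>.
\<close>

lemma odd_set_defines_facet:
  fixes \<eta> :: "bit ^ 'd::finite" and I :: "'n::finite set"
  assumes n: "CARD('n) \<ge> 3" and \<eta>: "\<eta> \<noteq> 0" and I: "odd (card I)"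
  shows "defines_facet (odd_set_lhs \<eta> I) 1 CTP"
proof -
  define V :: "(real ^ (bit ^ 'd) ^ 'n) set" where
    "V = incidence_vector ` {\<xi>. cyclic_transversal \<xi>}"
  define t :: "'n \<Rightarrow> bit" where "t i = (if i \<in> I then 0 else 1)" for i
  have hits_iff: "i \<in> hits \<eta> I \<xi> \<longleftrightarrow> scalar_product \<eta> (\<xi> i) = t i" for i \<xi>
    by (simp add: hits_def t_def)
  have "\<exists>x. scalar_product \<eta> x = t i" for i
    using scalar_product_surj[OF \<eta>] by metis
  then obtain \<beta> where \<beta>: "\<And>i. scalar_product \<eta> (\<beta> i) = t i"
    by metis
  have "\<exists>x. scalar_product \<eta> x \<noteq> t i" for i
    using scalar_product_surj[OF \<eta>] by (metis zero_neq_one)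
  then obtain \<gamma> where \<gamma>: "\<And>i. scalar_product \<eta> (\<gamma> i) \<noteq> t i"
    by metis
  define X :: "('n \<Rightarrow> bit ^ 'd) set" where "X = {\<xi>. cyclic_transversal \<xi> \<and> (\<exists>i. hits \<eta> I \<xi> = {i})}"
  have card1: "\<xi> \<in> X \<longleftrightarrow> cyclic_transversal \<xi> \<and> card (hits \<eta> I \<xi>) = 1" for \<xi>
    by (auto simp: X_def card_1_singleton_iff)
  obtain i\<^sub>0 j\<^sub>0 k\<^sub>0 :: 'n where ijk: "i\<^sub>0 \<noteq> j\<^sub>0" "i\<^sub>0 \<noteq> k\<^sub>0" "j\<^sub>0 \<noteq> k\<^sub>0"
    using ex_other_index[OF n] by metis
  define v where "v = complete_at k\<^sub>0 (\<lambda>m. if m = i\<^sub>0 then \<beta> m else \<gamma> m)"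
  define w where "w = complete_at k\<^sub>0 (\<lambda>m. if m = i\<^sub>0 \<or> m = j\<^sub>0 then \<beta> m else \<gamma> m)"
  have v: "v \<in> X"
  proof -
    have "hits \<eta> I (\<lambda>m. if m = i\<^sub>0 then \<beta> m else \<gamma> m) = {i\<^sub>0}"
      using \<beta> \<gamma> by (auto simp: hits_iff split: if_splits)
    then have "hits \<eta> I v = {i\<^sub>0}"
      unfolding v_def using I ijk by (intro hits_complete_at) auto
    then show ?thesis
      by (auto simp: X_def v_def cyclic_complete_at)
  qed
  have w: "card (hits \<eta> I w) \<noteq> 1"
  proof -
    have "{i\<^sub>0, j\<^sub>0} \<subseteq> hits \<eta> I w"
      using ijk \<beta> by (auto simp: w_def hits_iff complete_at_other)
    then show ?thesis
      using card_mono[of "hits \<eta> I w" "{i\<^sub>0, j\<^sub>0}"] ijk by simp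
  qed
  have w_cyclic: "cyclic_transversal w"
    by (simp add: w_def cyclic_complete_at)
  have "defines_facet (odd_set_lhs \<eta> I) 1 (convex hull V)"
  proof (rule defines_facet_if_functionals_extend)
    show "linear (odd_set_lhs \<eta> I)"
      by (rule linear_odd_set_lhs)
    show "1 \<le> odd_set_lhs \<eta> I u" if u: "u \<in> V" for u
    proof -
      obtain \<xi> where \<xi>: "u = incidence_vector \<xi>" "cyclic_transversal \<xi>"
        using u by (auto simp: V_def)
      then have "0 < card (hits \<eta> I \<xi>)"
        using odd_card_hits I odd_pos by metis
      then show ?thesis
        by (simp add: \<xi> odd_set_lhs_incidence_vector)
    qed
    show "incidence_vector v \<in> V"
      using v by (simp add: V_def X_def)
    show "odd_set_lhs \<eta> I (incidence_vector v) = 1"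
      using v by (simp add: card1 odd_set_lhs_incidence_vector)
    show "incidence_vector w \<in> V"
      using w_cyclic by (simp add: V_def)
    show "odd_set_lhs \<eta> I (incidence_vector w) \<noteq> 1"
      using w by (simp add: odd_set_lhs_incidence_vector)
    fix a u :: "real ^ (bit ^ 'd) ^ 'n"
    assume tight: "\<And>u. u \<in> V \<Longrightarrow>
        odd_set_lhs \<eta> I u = 1 \<Longrightarrow> a \<bullet> u = a \<bullet> incidence_vector w"
    define c where "c = a \<bullet> incidence_vector w"
    have agree: "(\<Sum>m\<in>UNIV. a $ m $ \<xi> m) = c" if "\<xi> \<in> X" for \<xi>
      using tight[of "incidence_vector \<xi>"] that
      by (simp add: V_def card1 odd_set_lhs_incidence_vector inner_incidence_vector c_def)
    have translate_X: "translate_pair p q h \<xi> \<in> X"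
      if "\<xi> \<in> X" "p \<noteq> q" "scalar_product \<eta> h = 0" for p q h \<xi>
    proof -
      have "hits \<eta> I (translate_pair p q h \<xi>) = hits \<eta> I \<xi>"
        using that(3) by (intro set_eqI) (simp add: hits_iff translate_pair_apply scalar_product_add)
      then show ?thesis
        using that by (auto simp: X_def cyclic_translate_pair)
    qed
    have const: "a $ j $ x = a $ j $ y" if xy: "scalar_product \<eta> x = scalar_product \<eta> y" for j x y
    proof -
      define h where "h = x + y"
      have h: "scalar_product \<eta> h = 0"
        using xy by (simp add: h_def scalar_product_add)
      obtain i where i: "i \<noteq> j"
        using ex_other_index[OF n] by metis
      obtain k where k: "k \<noteq> i" "k \<noteq> j"
        using ex_other_index[OF n] by metis
      \<comment> \<open>The single hit is placed at \<open>j\<close> if \<open>x\<close> is a hitting value there, and at \<open>i\<close> otherwise.\<close>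
      define \<zeta> where "\<zeta> = (\<lambda>m. if m = j then x else if m = i \<and> scalar_product \<eta> x \<noteq> t j then \<beta> m else \<gamma> m)"
      define l where "l = (if scalar_product \<eta> x = t j then j else i)"
      have "hits \<eta> I \<zeta> = {l}"
        using \<beta> \<gamma> i by (auto simp: hits_iff \<zeta>_def l_def split: if_splits)
      moreover have "l \<noteq> k"
        using k by (simp add: l_def)
      ultimately have "hits \<eta> I (complete_at k \<zeta>) = {l}"
        using I by (intro hits_complete_at) auto
      then have X: "complete_at k \<zeta> \<in> X"
        by (auto simp: X_def cyclic_complete_at)
      have "complete_at k \<zeta> j = x"
        using k by (simp add: complete_at_other \<zeta>_def)
      then have "a $ j $ (x + h) = a $ j $ x"
        using block_value_translation_invariant[of j i k X "\<lambda>m \<omega>. a $ m $ \<omega>", OF _ _ _ agree X]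
          translate_X[OF X _ h] i k by simp
      then show ?thesis
        by (simp add: h_def)
    qed
    define Q where "Q = (\<Sum>m\<in>UNIV. a $ m $ \<gamma> m)"
    define D where "D i = a $ i $ \<beta> i - a $ i $ \<gamma> i" for i
    have expand: "(\<Sum>m\<in>UNIV. a $ m $ \<xi> m) = Q + (\<Sum>m\<in>hits \<eta> I \<xi>. D m)" for \<xi>
    proof -
      have "a $ m $ \<xi> m = a $ m $ \<gamma> m + (if m \<in> hits \<eta> I \<xi> then D m else 0)" for m
      proof (cases "m \<in> hits \<eta> I \<xi>")
        case True
        then show ?thesis
          using const[of "\<xi> m" "\<beta> m" m] \<beta> by (simp add: hits_iff D_def)
      next
        case False
        then have "scalar_product \<eta> (\<xi> m) = scalar_product \<eta> (\<gamma> m)"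
          using \<gamma>[of m]
          by (cases "t m"; cases "scalar_product \<eta> (\<gamma> m)"; cases "scalar_product \<eta> (\<xi> m)")
            (auto simp: hits_iff)
        then show ?thesis
          using const[of "\<xi> m" "\<gamma> m" m] False by simp
      qed
      then have "(\<Sum>m\<in>UNIV. a $ m $ \<xi> m) = Q + (\<Sum>m\<in>UNIV. if m \<in> hits \<eta> I \<xi> then D m else 0)"
        unfolding Q_def by (simp only: sum.distrib)
      then show ?thesis
        by (simp add: sum.If_cases)
    qed
    have D: "D i = c - Q" for i
    proof -
      obtain k where k: "k \<noteq> i"
        using ex_other_index[OF n] by metis
      define \<xi> where "\<xi> = complete_at k (\<lambda>m. if m = i then \<beta> m else \<gamma> m)"
      have "hits \<eta> I (\<lambda>m. if m = i then \<beta> m else \<gamma> m) = {i}"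
        using \<beta> \<gamma> by (auto simp: hits_iff split: if_splits)
      then have hits: "hits \<eta> I \<xi> = {i}"
        unfolding \<xi>_def using I k by (intro hits_complete_at) auto
      then have "\<xi> \<in> X"
        by (auto simp: X_def \<xi>_def cyclic_complete_at)
      then show ?thesis
        using agree[of \<xi>] expand[of \<xi>] hits by simp
    qed
    have "c = Q + card (hits \<eta> I w) * (c - Q)"
      using expand[of w] by (simp add: c_def inner_incidence_vector D)
    then have "(real (card (hits \<eta> I w)) - 1) * (c - Q) = 0"
      by (simp add: algebra_simps)
    then have "c = Q"
      using w by simp
    moreover assume "u \<in> V"
    ultimately have "a \<bullet> u = c"
      by (auto simp: V_def inner_incidence_vector expand D)
    then show "a \<bullet> u = a \<bullet> incidence_vector w"
      by (simp add: c_def)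
  qed
  then show ?thesis
    by (simp add: CTP_def V_def)
qed

section \<open>Dimension, facets and affine hull of the full cyclic transversal polytope\<close>

theorem theorem4p4:
  fixes P :: "(real ^ (bit ^ 'd::finite) ^ 'n::finite) set"
  assumes P: "P = CTP"
    and n: "CARD('n) \<ge> 3"
  shows "affine hull P = {x. \<forall>i. (\<Sum>\<omega>\<in>UNIV. x $ i $ \<omega>) = 1}
    \<and> aff_dim P = int CARD('n) * (2 ^ CARD('d) - 1)
    \<and> (\<forall>i \<omega>. defines_facet (\<lambda>x. x $ i $ \<omega>) 0 P
              \<longleftrightarrow> (CARD('d), CARD('n)) \<noteq> (1, 3))
    \<and> (\<forall>\<eta> I. \<eta> \<noteq> 0 \<and> odd (card I) \<longrightarrow>
          defines_facet
            (\<lambda>x. (\<Sum>i\<in>I. \<Sum>\<omega> | scalar_product \<eta> \<omega> = 0. x $ i $ \<omega>)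
               + (\<Sum>i\<in>UNIV - I. \<Sum>\<omega> | scalar_product \<eta> \<omega> = 1. x $ i $ \<omega>)) 1 P)"
proof (intro conjI allI impI)
  show "affine hull P = {x. \<forall>i. (\<Sum>\<omega>\<in>UNIV. x $ i $ \<omega>) = 1}"
    using affine_hull_CTP[OF n] P by simp
  show "aff_dim P = int CARD('n) * (2 ^ CARD('d) - 1)"
    using aff_dim_CTP[OF n] P by simp
  show "defines_facet (\<lambda>x. x $ i $ \<omega>) 0 P \<longleftrightarrow> (CARD('d), CARD('n)) \<noteq> (1, 3)" for i \<omega>
  proof (cases "(CARD('d), CARD('n)) = (1, 3)")
    case True
    then show ?thesis
      using nonnegativity_not_facet_rank_1_length_3[where 'd = 'd and 'n = 'n] P by auto
  next
    case False
    then have "CARD('d) \<noteq> 1 \<or> CARD('n) \<noteq> 3"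
      by simp
    moreover have "CARD('d) > 0"
      by simp
    ultimately have "CARD('d) \<ge> 2 \<or> CARD('n) \<ge> 4"
      using n by linarith
    then show ?thesis
      using nonnegativity_defines_facet[OF n] False P by simp
  qed
  show "defines_facet
            (\<lambda>x. (\<Sum>i\<in>I. \<Sum>\<omega> | scalar_product \<eta> \<omega> = 0. x $ i $ \<omega>)
               + (\<Sum>i\<in>UNIV - I. \<Sum>\<omega> | scalar_product \<eta> \<omega> = 1. x $ i $ \<omega>)) 1 P"
    if "\<eta> \<noteq> 0 \<and> odd (card I)" for \<eta> :: "bit ^ 'd" and I :: "'n set"
    using odd_set_defines_facet[OF n] that P unfolding odd_set_lhs_def by blast
qed

end
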